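(* Let $\mathbf{C}$ be a category with all pullbacks, with an $\mathcal{M}$-partial map classifier $(T,\eta)$ for a stable system of monos $\mathcal{M}$, and with pushouts along arrows in $\mathcal{M}$. Let $\rho=L\xleftarrow{l}K\xrightarrow{r}R$ be a rule and $m:L\rightarrowtail G$ a match in $\mathcal{M}$. Then $G\Rightarrow^{\mathrm{SqPO}}_{\rho,m}H$ if and only if $G\Rightarrow^{\mathrm{AGREE}}_{(l,r,\eta_K),m}H$.
   Context: A stable system of monos $\mathcal{M}$ is a class of monos containing all isomorphisms, closed under composition, and stable under pullback. An $\mathcal{M}$-partial map classifier is a functor $T:\mathbf{C}\to\mathbf{C}$ with a natural transformation $\eta:\mathrm{Id}\Rightarrow T$ such that for every span $Z\xleftarrow{m}X\xrightarrow{f}Y$ with $m\in\mathcal{M}$ there is a unique arrow $\varphi(m,f):Z\to T(Y)$ making the square $\varphi(m,f)\circ m=\eta_Y\circ f$ a pullback. For $m:X\rightarrowtail Z$ in $\mathcal{M}$ write $\overline{m}=\varphi(m,\mathrm{id}_X)$. (One has $\eta_K\in\mathcal{M}$.) Final pullback complement: $K\xrightarrow{n}D\xrightarrow{a}G$ is a final pullback complement of $K\xrightarrow{l}L\xrightarrow{m}G$ if $a\circ n=m\circ l$ is a pullback and for every pullback $m\circ d=f\circ e$ ($d:K'\to L$, $e:K'\to D'$, $f:D'\to G$) and every $h:K'\to K$ with $l\circ h=d$ there is a unique $g:D'\to D$ with $a\circ g=f$ and $g\circ e=n\circ h$. SqPO rewriting: for a rule (span) $L\xleftarrow{l}K\xrightarrow{r}R$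 and match $m$, $G\Rightarrow^{\mathrm{SqPO}}_{\rho,m}H$ means: $K\xrightarrow{n}D\xrightarrow{a}G$ is a final pullback complement of $K\xrightarrow{l}L\xrightarrow{m}G$, and $R\to H\leftarrow D$ is a pushout of $R\xleftarrow{r}K\xrightarrow{n}D$. AGREE rewriting: for a rule $(K\xrightarrow{l}L,K\xrightarrow{r}R,K\xrightarrow{t}T_K)$ with $t\in\mathcal{M}$ and match $m:L\rightarrowtail G$ in $\mathcal{M}$: let $l'=\varphi(t,l):T_K\to T(L)$; let $G\xleftarrow{g}D\xrightarrow{n'}T_K$ be the pullback of $\overline{m}$ and $l'$; let $n:K\to D$ be the unique arrow with $n'\circ n=t$, $g\circ n=m\circ l$; then $H$ is the pushout object of $D\xleftarrow{n}K\xrightarrow{r}R$. This is written $G\Rightarrow^{\mathrm{AGREE}}_{(l,r,t),m}H$. *)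

theory Defs
  imports Main
begin

section \<open>Categories, functors, natural transformations\<close>

record ('o, 'a) category =
  Obj :: "'o set"
  Arr :: "'a set"
  Dom :: "'a \<Rightarrow> 'o"
  Cod :: "'a \<Rightarrow> 'o"
  Ident :: "'o \<Rightarrow> 'a"
  Comp :: "'a \<Rightarrow> 'a \<Rightarrow> 'a"  (infixr "\<cdot>\<index>" 70)

text \<open>Composition is written in applicative order: in \<open>g \<cdot> f\<close> the arrow \<open>f\<close> comes first.
  Its value matters only on composable pairs.\<close>

definition Hom :: "('o, 'a, 'x) category_scheme \<Rightarrow> 'o \<Rightarrow> 'o \<Rightarrow> 'a set" where
  "Hom C A B = {f \<in> Arr C. Dom C f = A \<and> Cod C f = B}"

locale category =
  fixes C :: "('o, 'a, 'x) category_scheme" (structure)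
  assumes Dom_in_Obj: "f \<in> Arr C \<Longrightarrow> Dom C f \<in> Obj C"
    and Cod_in_Obj: "f \<in> Arr C \<Longrightarrow> Cod C f \<in> Obj C"
    and Ident_in_Hom: "A \<in> Obj C \<Longrightarrow> Ident C A \<in> Hom C A A"
    and Comp_in_Hom: "f \<in> Hom C A B \<Longrightarrow> g \<in> Hom C B D \<Longrightarrow> g \<cdot> f \<in> Hom C A D"
    and Comp_Ident: "f \<in> Hom C A B \<Longrightarrow> f \<cdot> Ident C A = f"
    and Ident_Comp: "f \<in> Hom C A B \<Longrightarrow> Ident C B \<cdot> f = f"
    and Comp_assoc:
      "f \<in> Hom C A B \<Longrightarrow> g \<in> Hom C B D \<Longrightarrow> h \<in> Hom C D E \<Longrightarrow> (h \<cdot> g) \<cdot> f = h \<cdot> (g \<cdot> f)"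

locale cat_functor = source: category C + target: category D
  for C :: "('o, 'a, 'x) category_scheme" and D :: "('p, 'b, 'y) category_scheme" +
  fixes Fo :: "'o \<Rightarrow> 'p" and Fa :: "'a \<Rightarrow> 'b"
  assumes map_Obj: "A \<in> Obj C \<Longrightarrow> Fo A \<in> Obj D"
    and map_Hom: "f \<in> Hom C A B \<Longrightarrow> Fa f \<in> Hom D (Fo A) (Fo B)"
    and map_Ident: "A \<in> Obj C \<Longrightarrow> Fa (Ident C A) = Ident D (Fo A)"
    and map_Comp: "f \<in> Hom C A B \<Longrightarrow> g \<in> Hom C B E \<Longrightarrow>
      Fa (g \<cdot>\<^bsub>C\<^esub> f) = Fa g \<cdot>\<^bsub>D\<^esub> Fa f"

locale nat_transformation = F: cat_functor C D Fo Fa + G: cat_functor C D Go Ga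
  for C :: "('o, 'a, 'x) category_scheme" and D :: "('p, 'b, 'y) category_scheme"
    and Fo Fa Go Ga +
  fixes \<tau> :: "'o \<Rightarrow> 'b"
  assumes component_in_Hom: "A \<in> Obj C \<Longrightarrow> \<tau> A \<in> Hom D (Fo A) (Go A)"
    and naturality: "f \<in> Hom C A B \<Longrightarrow> \<tau> B \<cdot>\<^bsub>D\<^esub> Fa f = Ga f \<cdot>\<^bsub>D\<^esub> \<tau> A"


section \<open>Monos, isos, pullbacks, pushouts\<close>

definition is_mono :: "('o, 'a, 'x) category_scheme \<Rightarrow> 'a \<Rightarrow> bool" where
  "is_mono C m \<longleftrightarrow> m \<in> Arr C \<and>
    (\<forall>X. \<forall>f \<in> Hom C X (Dom C m). \<forall>g \<in> Hom C X (Dom C m).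
       m \<cdot>\<^bsub>C\<^esub> f = m \<cdot>\<^bsub>C\<^esub> g \<longrightarrow> f = g)"

definition is_iso :: "('o, 'a, 'x) category_scheme \<Rightarrow> 'a \<Rightarrow> bool" where
  "is_iso C f \<longleftrightarrow> f \<in> Arr C \<and>
    (\<exists>g \<in> Hom C (Cod C f) (Dom C f).
       g \<cdot>\<^bsub>C\<^esub> f = Ident C (Dom C f) \<and> f \<cdot>\<^bsub>C\<^esub> g = Ident C (Cod C f))"

text \<open>\<open>is_pullback C f g p q\<close>: the square \<open>f \<cdot> p = g \<cdot> q\<close> is a pullback (of \<open>f\<close> and \<open>g\<close>).\<close>

definition is_pullback :: "('o, 'a, 'x) category_scheme \<Rightarrow> 'a \<Rightarrow> 'a \<Rightarrow> 'a \<Rightarrow> 'a \<Rightarrow> bool" where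
  "is_pullback C f g p q \<longleftrightarrow>
    f \<in> Arr C \<and> g \<in> Arr C \<and> Cod C f = Cod C g \<and>
    p \<in> Hom C (Dom C p) (Dom C f) \<and> q \<in> Hom C (Dom C p) (Dom C g) \<and>
    f \<cdot>\<^bsub>C\<^esub> p = g \<cdot>\<^bsub>C\<^esub> q \<and>
    (\<forall>X. \<forall>x \<in> Hom C X (Dom C f). \<forall>y \<in> Hom C X (Dom C g). f \<cdot>\<^bsub>C\<^esub> x = g \<cdot>\<^bsub>C\<^esub> y \<longrightarrow>
       (\<exists>!u. u \<in> Hom C X (Dom C p) \<and> p \<cdot>\<^bsub>C\<^esub> u = x \<and> q \<cdot>\<^bsub>C\<^esub> u = y))"

text \<open>\<open>is_pushout C f g i j\<close>: the square \<open>i \<cdot> f = j \<cdot> g\<close> is a pushout (of \<open>f\<close> and \<open>g\<close>).\<close>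

definition is_pushout :: "('o, 'a, 'x) category_scheme \<Rightarrow> 'a \<Rightarrow> 'a \<Rightarrow> 'a \<Rightarrow> 'a \<Rightarrow> bool" where
  "is_pushout C f g i j \<longleftrightarrow>
    f \<in> Arr C \<and> g \<in> Arr C \<and> Dom C f = Dom C g \<and>
    i \<in> Hom C (Cod C f) (Cod C i) \<and> j \<in> Hom C (Cod C g) (Cod C i) \<and>
    i \<cdot>\<^bsub>C\<^esub> f = j \<cdot>\<^bsub>C\<^esub> g \<and>
    (\<forall>X. \<forall>x \<in> Hom C (Cod C f) X. \<forall>y \<in> Hom C (Cod C g) X. x \<cdot>\<^bsub>C\<^esub> f = y \<cdot>\<^bsub>C\<^esub> g \<longrightarrow>
       (\<exists>!u. u \<in> Hom C (Cod C i) X \<and> u \<cdot>\<^bsub>C\<^esub> i = x \<and> u \<cdot>\<^bsub>C\<^esub> j = y))"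

definition has_pullbacks :: "('o, 'a, 'x) category_scheme \<Rightarrow> bool" where
  "has_pullbacks C \<longleftrightarrow>
    (\<forall>f \<in> Arr C. \<forall>g \<in> Arr C. Cod C f = Cod C g \<longrightarrow> (\<exists>p q. is_pullback C f g p q))"

definition has_pushouts_along :: "('o, 'a, 'x) category_scheme \<Rightarrow> 'a set \<Rightarrow> bool" where
  "has_pushouts_along C M \<longleftrightarrow>
    (\<forall>f \<in> Arr C. \<forall>g \<in> M. Dom C f = Dom C g \<longrightarrow> (\<exists>i j. is_pushout C f g i j))"


section \<open>Stable systems of monos and partial map classifiers\<close>

definition stable_system_of_monos :: "('o, 'a, 'x) category_scheme \<Rightarrow> 'a set \<Rightarrow> bool" where
  "stable_system_of_monos C M \<longleftrightarrow>
    (\<forall>m \<in> M. is_mono C m) \<and>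
    (\<forall>f. is_iso C f \<longrightarrow> f \<in> M) \<and>
    (\<forall>f \<in> M. \<forall>g \<in> M. Cod C f = Dom C g \<longrightarrow> g \<cdot>\<^bsub>C\<^esub> f \<in> M) \<and>
    (\<forall>f m p q. is_pullback C f m p q \<longrightarrow> m \<in> M \<longrightarrow> p \<in> M)"

text \<open>\<open>To\<close> and \<open>Ta\<close> are the object and arrow parts of the functor \<open>T\<close>. The condition
  \<open>\<eta> Y \<in> M\<close> is part of the usual notion (partial maps \<open>Z \<rightharpoonup> Y\<close> correspond bijectively to
  arrows \<open>Z \<rightarrow> T Y\<close> by pulling back \<open>\<eta> Y\<close>). It does not follow from the existence and
  uniqueness of classifying arrows: if \<open>M\<close> consists of the isos only, then any natural
  transformation \<open>\<eta>\<close> with monic components satisfies all the other conditions. It is what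
  makes \<open>\<eta> K\<close> admissible as third component of an AGREE rule.\<close>

definition partial_map_classifier ::
  "('o, 'a, 'x) category_scheme \<Rightarrow> 'a set \<Rightarrow> ('o \<Rightarrow> 'o) \<Rightarrow> ('a \<Rightarrow> 'a) \<Rightarrow> ('o \<Rightarrow> 'a) \<Rightarrow> bool" where
  "partial_map_classifier C M To Ta \<eta> \<longleftrightarrow>
    cat_functor C C To Ta \<and>
    nat_transformation C C (\<lambda>A. A) (\<lambda>f. f) To Ta \<eta> \<and>
    (\<forall>Y \<in> Obj C. \<eta> Y \<in> M) \<and>
    (\<forall>X Y Z. \<forall>m \<in> M \<inter> Hom C X Z. \<forall>f \<in> Hom C X Y.
       \<exists>!\<phi>. \<phi> \<in> Hom C Z (To Y) \<and> is_pullback C \<phi> (\<eta> Y) m f)"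

text \<open>The arrow \<open>\<phi>(m, f)\<close>; the arrow written \<open>m\<close> with an overline is \<open>\<phi>(m, id)\<close>.\<close>

definition classifying_arrow ::
  "('o, 'a, 'x) category_scheme \<Rightarrow> ('o \<Rightarrow> 'o) \<Rightarrow> ('o \<Rightarrow> 'a) \<Rightarrow> 'a \<Rightarrow> 'a \<Rightarrow> 'a" where
  "classifying_arrow C To \<eta> m f =
    (THE \<phi>. \<phi> \<in> Hom C (Cod C m) (To (Cod C f)) \<and> is_pullback C \<phi> (\<eta> (Cod C f)) m f)"

definition mono_classifying_arrow ::
  "('o, 'a, 'x) category_scheme \<Rightarrow> ('o \<Rightarrow> 'o) \<Rightarrow> ('o \<Rightarrow> 'a) \<Rightarrow> 'a \<Rightarrow> 'a" where
  "mono_classifying_arrow C To \<eta> m = classifying_arrow C To \<eta> m (Ident C (Dom C m))"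


section \<open>Sesqui-pushout and AGREE rewriting\<close>

text \<open>\<open>final_pullback_complement C l m n a\<close>: \<open>K -n\<rightarrow> D -a\<rightarrow> G\<close> is a final pullback
  complement of \<open>K -l\<rightarrow> L -m\<rightarrow> G\<close>. In the universal property \<open>d : K' \<rightarrow> L\<close>,
  \<open>e : K' \<rightarrow> D'\<close>, \<open>f : D' \<rightarrow> G\<close>.\<close>

definition final_pullback_complement ::
  "('o, 'a, 'x) category_scheme \<Rightarrow> 'a \<Rightarrow> 'a \<Rightarrow> 'a \<Rightarrow> 'a \<Rightarrow> bool" where
  "final_pullback_complement C l m n a \<longleftrightarrow>
    is_pullback C a m n l \<and>
    (\<forall>d e f h. is_pullback C m f d e \<longrightarrow> h \<in> Hom C (Dom C d) (Dom C l) \<longrightarrow> l \<cdot>\<^bsub>C\<^esub> h = d \<longrightarrow>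
       (\<exists>!g. g \<in> Hom C (Dom C f) (Dom C a) \<and> a \<cdot>\<^bsub>C\<^esub> g = f \<and> g \<cdot>\<^bsub>C\<^esub> e = n \<cdot>\<^bsub>C\<^esub> h))"

definition is_span :: "('o, 'a, 'x) category_scheme \<Rightarrow> 'a \<Rightarrow> 'a \<Rightarrow> bool" where
  "is_span C l r \<longleftrightarrow> l \<in> Arr C \<and> r \<in> Arr C \<and> Dom C l = Dom C r"

definition agree_rule :: "('o, 'a, 'x) category_scheme \<Rightarrow> 'a set \<Rightarrow> 'a \<Rightarrow> 'a \<Rightarrow> 'a \<Rightarrow> bool" where
  "agree_rule C M l r t \<longleftrightarrow> is_span C l r \<and> t \<in> Arr C \<and> Dom C t = Dom C l \<and> t \<in> M"

definition sqpo_step ::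
  "('o, 'a, 'x) category_scheme \<Rightarrow> 'a \<Rightarrow> 'a \<Rightarrow> 'a \<Rightarrow> 'o \<Rightarrow> 'o \<Rightarrow> bool" where
  "sqpo_step C l r m G H \<longleftrightarrow>
    is_span C l r \<and> m \<in> Hom C (Cod C l) G \<and>
    (\<exists>n a i j. final_pullback_complement C l m n a \<and>
       is_pushout C r n i j \<and> Cod C i = H)"

text \<open>The arrow \<open>n\<close> below is determined by the two equations, by the universal property of
  the pullback.\<close>

definition agree_step ::
  "('o, 'a, 'x) category_scheme \<Rightarrow> 'a set \<Rightarrow> ('o \<Rightarrow> 'o) \<Rightarrow> ('o \<Rightarrow> 'a) \<Rightarrow>
    'a \<Rightarrow> 'a \<Rightarrow> 'a \<Rightarrow> 'a \<Rightarrow> 'o \<Rightarrow> 'o \<Rightarrow> bool" where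
  "agree_step C M To \<eta> l r t m G H \<longleftrightarrow>
    agree_rule C M l r t \<and> m \<in> Hom C (Cod C l) G \<and> m \<in> M \<and>
    (\<exists>g n' n i j.
       is_pullback C (mono_classifying_arrow C To \<eta> m) (classifying_arrow C To \<eta> t l) g n' \<and>
       n \<in> Hom C (Dom C l) (Dom C g) \<and> n' \<cdot>\<^bsub>C\<^esub> n = t \<and> g \<cdot>\<^bsub>C\<^esub> n = m \<cdot>\<^bsub>C\<^esub> l \<and>
       is_pushout C r n i j \<and> Cod C i = H)"

end

theory Submission
  imports Defs
begin

text \<open>
  Both kinds of steps push out \<open>r\<close> along the arrow \<open>n\<close> of a pair \<open>K -n\<rightarrow> D -a\<rightarrow> G\<close>, so it
  suffices that such a pair is a final pullback complement of \<open>(l, m)\<close> iff it arises from a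
  pullback of \<open>\<phi>(m, id)\<close> and \<open>\<phi>(\<eta> K, l)\<close>. An arrow \<open>D' \<rightarrow> T K\<close> is the same as a partial map
  \<open>(e, h)\<close> from \<open>D'\<close> to \<open>K\<close>. By pasting of pullbacks, \<open>\<phi>(\<eta> K, l) \<cdot> \<phi>(e, h) = \<phi>(e, l \<cdot> h)\<close>,
  and this equals \<open>\<phi>(m, id) \<cdot> f\<close> iff \<open>f \<cdot> e = m \<cdot> (l \<cdot> h)\<close> is a pullback. Hence the cones over
  \<open>\<phi>(m, id)\<close> and \<open>\<phi>(\<eta> K, l)\<close> are exactly the data in the universal property of the final
  pullback complement.
\<close>

section \<open>Hom-sets and the pullback predicate\<close>

lemma HomD:
  assumes "f \<in> Hom C A B"
  shows "f \<in> Arr C" "Dom C f = A" "Cod C f = B"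
  using assms by (auto simp: Hom_def)

lemma pullback_HomD:
  assumes "is_pullback C f g p q"
  shows "f \<in> Hom C (Dom C f) (Cod C g)" "g \<in> Hom C (Dom C g) (Cod C g)"
    "p \<in> Hom C (Dom C p) (Dom C f)" "q \<in> Hom C (Dom C p) (Dom C g)"
  using assms by (auto simp: is_pullback_def Hom_def)

lemma pullback_commutes: "is_pullback C f g p q \<Longrightarrow> f \<cdot>\<^bsub>C\<^esub> p = g \<cdot>\<^bsub>C\<^esub> q"
  by (simp add: is_pullback_def)

lemma pullback_ex1:
  assumes "is_pullback C f g p q"
    and "x \<in> Hom C X (Dom C f)" "y \<in> Hom C X (Dom C g)" "f \<cdot>\<^bsub>C\<^esub> x = g \<cdot>\<^bsub>C\<^esub> y"
  shows "\<exists>!u. u \<in> Hom C X (Dom C p) \<and> p \<cdot>\<^bsub>C\<^esub> u = x \<and> q \<cdot>\<^bsub>C\<^esub> u = y"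
  using assms unfolding is_pullback_def by blast

text \<open>Unique existence is split into existence and joint monicity, and the objects are named,
  so that no \<open>Dom\<close> or \<open>Cod\<close> terms are left in the proof
  obligations.\<close>

lemma pullbackI:
  assumes "f \<in> Hom C A E" "g \<in> Hom C B E" "p \<in> Hom C P A" "q \<in> Hom C P B"
    and "f \<cdot>\<^bsub>C\<^esub> p = g \<cdot>\<^bsub>C\<^esub> q"
    and "\<And>X x y. x \<in> Hom C X A \<Longrightarrow> y \<in> Hom C X B \<Longrightarrow> f \<cdot>\<^bsub>C\<^esub> x = g \<cdot>\<^bsub>C\<^esub> y \<Longrightarrow>
      \<exists>u \<in> Hom C X P. p \<cdot>\<^bsub>C\<^esub> u = x \<and> q \<cdot>\<^bsub>C\<^esub> u = y"
    and "\<And>X u v. u \<in> Hom C X P \<Longrightarrow> v \<in> Hom C X P \<Longrightarrow>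
      p \<cdot>\<^bsub>C\<^esub> u = p \<cdot>\<^bsub>C\<^esub> v \<Longrightarrow> q \<cdot>\<^bsub>C\<^esub> u = q \<cdot>\<^bsub>C\<^esub> v \<Longrightarrow> u = v"
  shows "is_pullback C f g p q"
  unfolding is_pullback_def HomD(2)[OF assms(1)] HomD(2)[OF assms(2)] HomD(2)[OF assms(3)]
    HomD(3)[OF assms(1)] HomD(3)[OF assms(2)]
proof (intro conjI allI ballI impI)
  fix X x y
  assume "x \<in> Hom C X A" "y \<in> Hom C X B" "f \<cdot>\<^bsub>C\<^esub> x = g \<cdot>\<^bsub>C\<^esub> y"
  from assms(6)[OF this] obtain u
    where u: "u \<in> Hom C X P" "p \<cdot>\<^bsub>C\<^esub> u = x" "q \<cdot>\<^bsub>C\<^esub> u = y" by blast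
  show "\<exists>!u. u \<in> Hom C X P \<and> p \<cdot>\<^bsub>C\<^esub> u = x \<and> q \<cdot>\<^bsub>C\<^esub> u = y"
  proof (rule ex1I)
    show "v = u" if "v \<in> Hom C X P \<and> p \<cdot>\<^bsub>C\<^esub> v = x \<and> q \<cdot>\<^bsub>C\<^esub> v = y" for v
      by (rule assms(7)[of _ X]) (simp_all add: u that)
  qed (simp add: u)
qed (use HomD(1)[OF assms(1)] HomD(1)[OF assms(2)] assms(3-5) in auto)

section \<open>Pasting and cancellation of pullback squares\<close>

context category
begin

lemma Comp_assoc4:
  assumes "g \<cdot> f = k \<cdot> h"
    and "f \<in> Hom C A B" "g \<in> Hom C B D" "h \<in> Hom C A B'" "k \<in> Hom C B' D" "j \<in> Hom C D E"
  shows "(j \<cdot> g) \<cdot> f = (j \<cdot> k) \<cdot> h"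
  by (simp add: Comp_assoc[OF assms(2,3,6)] Comp_assoc[OF assms(4,5,6)] assms(1))

text \<open>Both arrows mediate the single cone \<open>(p \<cdot> u, q \<cdot> u)\<close>, and
  mediating arrows are unique.\<close>

lemma pullback_joint_monic:
  assumes pb: "is_pullback C f g p q"
    and u: "u \<in> Hom C X (Dom C p)" and v: "v \<in> Hom C X (Dom C p)"
    and "p \<cdot> u = p \<cdot> v" "q \<cdot> u = q \<cdot> v"
  shows "u = v"
proof -
  note pbh = pullback_HomD[OF pb]
  have "f \<cdot> (p \<cdot> u) = g \<cdot> (q \<cdot> u)"
    using Comp_assoc[OF u pbh(3,1)] Comp_assoc[OF u pbh(4,2)] pullback_commutes[OF pb] by simp
  from pullback_ex1[OF pb Comp_in_Hom[OF u pbh(3)] Comp_in_Hom[OF u pbh(4)] this]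
  show ?thesis using assms by auto
qed

lemma pullback_sym:
  assumes pb: "is_pullback C f g p q"
  shows "is_pullback C g f q p"
proof -
  note pbh = pullback_HomD[OF pb]
  show ?thesis
  proof (rule pullbackI[OF pbh(2,1,4,3) pullback_commutes[OF pb, symmetric]])
    fix X x y
    assume x: "x \<in> Hom C X (Dom C g)" and y: "y \<in> Hom C X (Dom C f)"
      and xy: "g \<cdot> x = f \<cdot> y"
    from pullback_ex1[OF pb y x xy[symmetric]]
    show "\<exists>u \<in> Hom C X (Dom C p). q \<cdot> u = x \<and> p \<cdot> u = y" by blast
  next
    fix X u v
    assume "u \<in> Hom C X (Dom C p)" "v \<in> Hom C X (Dom C p)" "q \<cdot> u = q \<cdot> v" "p \<cdot> u = p \<cdot> v"
    then show "u = v" using pullback_joint_monic[OF pb] by blast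
  qed
qed

text \<open>A cone \<open>(x, y)\<close> over the composite yields the cone
  \<open>(h \<cdot> x, y)\<close> over the right square; its mediating arrow, paired with
  \<open>x\<close>, is a cone over the left square.\<close>

lemma pullback_paste:
  assumes right: "is_pullback C f g p q" and left: "is_pullback C h p u v"
  shows "is_pullback C (f \<cdot> h) g u (q \<cdot> v)"
proof -
  note r = pullback_HomD[OF right]
  note l = pullback_HomD[OF left]
  have h: "h \<in> Hom C (Dom C h) (Dom C f)" and v: "v \<in> Hom C (Dom C u) (Dom C p)"
    using l r HomD(3) by metis+
  show ?thesis
  proof (rule pullbackI[OF Comp_in_Hom[OF h r(1)] r(2) l(3) Comp_in_Hom[OF v r(4)]])
    have "(f \<cdot> h) \<cdot> u = (f \<cdot> p) \<cdot> v"
      by (rule Comp_assoc4[OF pullback_commutes[OF left] l(3) h v r(3,1)])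
    also have "\<dots> = g \<cdot> (q \<cdot> v)"
      using Comp_assoc[OF v r(4,2)] pullback_commutes[OF right] by simp
    finally show "(f \<cdot> h) \<cdot> u = g \<cdot> (q \<cdot> v)" .
  next
    fix X x y
    assume x: "x \<in> Hom C X (Dom C h)" and y: "y \<in> Hom C X (Dom C g)"
      and xy: "(f \<cdot> h) \<cdot> x = g \<cdot> y"
    have "f \<cdot> (h \<cdot> x) = g \<cdot> y"
      using xy Comp_assoc[OF x h r(1)] by simp
    with pullback_ex1[OF right Comp_in_Hom[OF x h] y] obtain w
      where w: "w \<in> Hom C X (Dom C p)" "p \<cdot> w = h \<cdot> x" "q \<cdot> w = y" by blast
    with pullback_ex1[OF left x w(1)] obtain s
      where s: "s \<in> Hom C X (Dom C u)" "u \<cdot> s = x" "v \<cdot> s = w" by metis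
    then show "\<exists>s \<in> Hom C X (Dom C u). u \<cdot> s = x \<and> (q \<cdot> v) \<cdot> s = y"
      using w Comp_assoc[OF s(1) v r(4)] by auto
  next
    fix X s t
    assume s: "s \<in> Hom C X (Dom C u)" and t: "t \<in> Hom C X (Dom C u)"
      and us: "u \<cdot> s = u \<cdot> t" and "(q \<cdot> v) \<cdot> s = (q \<cdot> v) \<cdot> t"
    then have "q \<cdot> (v \<cdot> s) = q \<cdot> (v \<cdot> t)"
      using Comp_assoc[OF s v r(4)] Comp_assoc[OF t v r(4)] by simp
    moreover have "p \<cdot> (v \<cdot> s) = p \<cdot> (v \<cdot> t)"
      using Comp_assoc[OF s v r(3)] Comp_assoc[OF t v r(3)] pullback_commutes[OF left]
        Comp_assoc[OF s l(3) h] Comp_assoc[OF t l(3) h] us by metis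
    ultimately have "v \<cdot> s = v \<cdot> t"
      using pullback_joint_monic[OF right Comp_in_Hom[OF s v] Comp_in_Hom[OF t v]] by blast
    then show "s = t"
      using pullback_joint_monic[OF left s t us] by blast
  qed
qed

text \<open>Composing the second leg of a cone \<open>(x, y)\<close> with \<open>q\<close> gives a
  cone over the outer square. Its mediating arrow \<open>s\<close> satisfies
  \<open>v \<cdot> s = y\<close> because both sides agree after \<open>p\<close> and after
  \<open>q\<close>.\<close>

lemma pullback_cancel:
  assumes right: "is_pullback C f g p q" and outer: "is_pullback C (f \<cdot> h) g u (q \<cdot> v)"
    and h: "h \<in> Hom C X (Dom C f)" and v: "v \<in> Hom C (Dom C u) (Dom C p)"
    and comm: "h \<cdot> u = p \<cdot> v"
  shows "is_pullback C h p u v"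
proof -
  note r = pullback_HomD[OF right]
  note o = pullback_HomD[OF outer]
  have dom: "Dom C (f \<cdot> h) = X"
    by (rule HomD(2)[OF Comp_in_Hom[OF h r(1)]])
  have u: "u \<in> Hom C (Dom C u) X"
    using o(3) by (simp add: dom)
  show ?thesis
  proof (rule pullbackI[OF h r(3) u v comm])
    fix Y x y
    assume x: "x \<in> Hom C Y X" and y: "y \<in> Hom C Y (Dom C p)" and xy: "h \<cdot> x = p \<cdot> y"
    have "(f \<cdot> h) \<cdot> x = (f \<cdot> p) \<cdot> y"
      by (rule Comp_assoc4[OF xy x h y r(3,1)])
    also have "\<dots> = g \<cdot> (q \<cdot> y)"
      using Comp_assoc[OF y r(4,2)] pullback_commutes[OF right] by simp
    finally obtain s where s: "s \<in> Hom C Y (Dom C u)" "u \<cdot> s = x" "(q \<cdot> v) \<cdot> s = q \<cdot> y"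
      using pullback_ex1[OF outer, unfolded dom, OF x Comp_in_Hom[OF y r(4)]] by blast
    have "p \<cdot> (v \<cdot> s) = p \<cdot> y"
      using Comp_assoc[OF s(1) v r(3)] Comp_assoc[OF s(1) u h] comm s(2) xy by simp
    moreover have "q \<cdot> (v \<cdot> s) = q \<cdot> y"
      using Comp_assoc[OF s(1) v r(4)] s(3) by simp
    ultimately have "v \<cdot> s = y"
      using pullback_joint_monic[OF right Comp_in_Hom[OF s(1) v] y] by blast
    with s show "\<exists>s \<in> Hom C Y (Dom C u). u \<cdot> s = x \<and> v \<cdot> s = y" by blast
  next
    fix Y s t
    assume s: "s \<in> Hom C Y (Dom C u)" and t: "t \<in> Hom C Y (Dom C u)"
      and us: "u \<cdot> s = u \<cdot> t" and "v \<cdot> s = v \<cdot> t"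
    then have "(q \<cdot> v) \<cdot> s = (q \<cdot> v) \<cdot> t"
      using Comp_assoc[OF s v r(4)] Comp_assoc[OF t v r(4)] by simp
    then show "s = t"
      by (rule pullback_joint_monic[OF outer s t us])
  qed
qed

end

section \<open>Classifying arrows and final pullback complements\<close>

locale classified_category = category C
  for C :: "('o, 'a, 'x) category_scheme" (structure) +
  fixes M :: "'a set" and To :: "'o \<Rightarrow> 'o" and Ta :: "'a \<Rightarrow> 'a" and \<eta> :: "'o \<Rightarrow> 'a"
  assumes stable: "stable_system_of_monos C M"
    and classifier: "partial_map_classifier C M To Ta \<eta>"
    and pullbacks: "has_pullbacks C"
begin

abbreviation "\<phi> \<equiv> classifying_arrow C To \<eta>"

lemma M_pullback: "is_pullback C f m p q \<Longrightarrow> m \<in> M \<Longrightarrow> p \<in> M"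
  using stable unfolding stable_system_of_monos_def by blast

lemma unit_in_M: "Y \<in> Obj C \<Longrightarrow> \<eta> Y \<in> M"
  using classifier unfolding partial_map_classifier_def by blast

lemma unit_in_Hom: "Y \<in> Obj C \<Longrightarrow> \<eta> Y \<in> Hom C Y (To Y)"
  using classifier nat_transformation.component_in_Hom unfolding partial_map_classifier_def
  by fast

text \<open>Turns the definite description into its characteristic properties. Equalities of arrows
  into \<open>To Y\<close> are later proved by showing that both sides classify the same partial
  map.\<close>

lemma classifying_arrow:
  assumes "m \<in> M" "m \<in> Hom C X Z" "f \<in> Hom C X Y"
  shows classifying_arrow_in_Hom: "\<phi> m f \<in> Hom C Z (To Y)"
    and classifying_arrow_pullback: "is_pullback C (\<phi> m f) (\<eta> Y) m f"
    and classifying_arrow_unique: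
      "\<psi> \<in> Hom C Z (To Y) \<Longrightarrow> is_pullback C \<psi> (\<eta> Y) m f \<Longrightarrow> \<psi> = \<phi> m f"
proof -
  have ex1: "\<exists>!\<psi>. \<psi> \<in> Hom C Z (To Y) \<and> is_pullback C \<psi> (\<eta> Y) m f"
    using classifier assms unfolding partial_map_classifier_def by blast
  have eq: "\<phi> m f = (THE \<psi>. \<psi> \<in> Hom C Z (To Y) \<and> is_pullback C \<psi> (\<eta> Y) m f)"
    using assms(2,3) by (simp add: classifying_arrow_def HomD)
  show "\<phi> m f \<in> Hom C Z (To Y)" "is_pullback C (\<phi> m f) (\<eta> Y) m f"
    unfolding eq using theI'[OF ex1] by blast+
  then show "\<psi> \<in> Hom C Z (To Y) \<Longrightarrow> is_pullback C \<psi> (\<eta> Y) m f \<Longrightarrow> \<psi> = \<phi> m f"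
    using ex1 by blast
qed

text \<open>The same \<open>n\<close> and \<open>a\<close> stand on both sides, so the pushout
  condition carries over unchanged and no comparison up to isomorphism is needed.\<close>

lemma final_pullback_complement_iff:
  assumes l: "l \<in> Hom C K L" and m: "m \<in> Hom C L G" and mM: "m \<in> M"
  shows "final_pullback_complement C l m n a \<longleftrightarrow>
    (\<exists>n'. is_pullback C (\<phi> m (Ident C L)) (\<phi> (\<eta> K) l) a n' \<and>
      n \<in> Hom C K (Dom C a) \<and> n' \<cdot> n = \<eta> K \<and> a \<cdot> n = m \<cdot> l)"
    (is "?fpc \<longleftrightarrow> (\<exists>n'. ?agree n')")
proof -
  define mb where "mb = \<phi> m (Ident C L)"
  define l' where "l' = \<phi> (\<eta> K) l"
  have K: "K \<in> Obj C" and L: "L \<in> Obj C"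
    using l Dom_in_Obj Cod_in_Obj HomD by metis+
  note etaK = unit_in_Hom[OF K] and etaKM = unit_in_M[OF K]
  note etaL = unit_in_Hom[OF L]
  note idL = Ident_in_Hom[OF L] and idK = Ident_in_Hom[OF K]
  have mb: "mb \<in> Hom C G (To L)" and mb_pb: "is_pullback C mb (\<eta> L) m (Ident C L)"
    unfolding mb_def by (rule classifying_arrow[OF mM m idL])+
  have l': "l' \<in> Hom C (To K) (To L)" and l'_pb: "is_pullback C l' (\<eta> L) (\<eta> K) l"
    unfolding l'_def by (rule classifying_arrow[OF etaKM etaK l])+
  have dom: "Dom C l = K" "Dom C m = L" "Dom C mb = G" "Dom C l' = To K"
    "Dom C (\<eta> K) = K" "Dom C (\<eta> L) = L"
    using HomD(2) l m mb l' etaK etaL by metis+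
  \<comment> \<open>The pasted square says that \<open>mb \<cdot> f\<close> classifies the partial
    map \<open>(e, d)\<close> into \<open>L\<close>; \<open>mb_cancel\<close> is the converse, given
    commutativity.\<close>
  have mb_comp: "is_pullback C (mb \<cdot> f) (\<eta> L) e d" if "is_pullback C f m e d" for f e d
    using pullback_paste[OF mb_pb that] pullback_HomD(4)[OF that] dom Ident_Comp by auto
  have mb_cancel: "is_pullback C f m e d"
    if "is_pullback C (mb \<cdot> f) (\<eta> L) e d" "f \<in> Hom C D' G" "f \<cdot> e = m \<cdot> d" for f e d D'
  proof (rule pullback_cancel[OF mb_pb _ _ _ that(3)])
    have d: "d \<in> Hom C (Dom C e) L"
      using pullback_HomD(4)[OF that(1)] dom by simp
    then show "is_pullback C (mb \<cdot> f) (\<eta> L) e (Ident C L \<cdot> d)"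
      "d \<in> Hom C (Dom C e) (Dom C m)"
      using that(1) Ident_Comp dom by auto
    show "f \<in> Hom C D' (Dom C mb)" using that(2) dom by simp
  qed
  \<comment> \<open>If \<open>y\<close> classifies \<open>(e, h)\<close>, then
    \<open>l' \<cdot> y\<close> classifies \<open>(e, l \<cdot> h)\<close>.\<close>
  note l'_comp = pullback_paste[OF l'_pb]
  show ?thesis
    unfolding mb_def[symmetric] l'_def[symmetric]
  proof
    assume fpc: "final_pullback_complement C l m n a"
    then have sq: "is_pullback C a m n l"
      unfolding final_pullback_complement_def by blast
    have fin: "\<exists>!g. g \<in> Hom C (Dom C f) (Dom C a) \<and> a \<cdot> g = f \<and> g \<cdot> e = n \<cdot> h"
      if "is_pullback C m f d e" "h \<in> Hom C (Dom C d) K" "l \<cdot> h = d" for d e f h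
      using fpc that unfolding final_pullback_complement_def dom by blast
    define D where "D = Dom C a"
    have a: "a \<in> Hom C D G" and n: "n \<in> Hom C K D"
      using pullback_HomD[OF sq] HomD[OF l] HomD[OF m] unfolding D_def by (auto simp: Hom_def)
    have nM: "n \<in> M" using M_pullback[OF sq mM] .
    \<comment> \<open>As a pullback of \<open>m\<close>, the arrow \<open>n\<close> lies in
      \<open>M\<close>; \<open>n'\<close> represents its partial inverse from \<open>D\<close> to
      \<open>K\<close>.\<close>
    define n' where "n' = \<phi> n (Ident C K)"
    have n': "n' \<in> Hom C D (To K)" and n'_pb: "is_pullback C n' (\<eta> K) n (Ident C K)"
      unfolding n'_def by (rule classifying_arrow[OF nM n idK])+
    have n'n: "n' \<cdot> n = \<eta> K"
      using pullback_commutes[OF n'_pb] Comp_Ident[OF etaK] by simp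
    \<comment> \<open>The square commutes since both composites classify
      \<open>(n, l)\<close>.\<close>
    have "l' \<cdot> n' = \<phi> n l"
      using classifying_arrow_unique[OF nM n l Comp_in_Hom[OF n' l']] l'_comp[OF n'_pb]
        Comp_Ident[OF l] by simp
    moreover have "mb \<cdot> a = \<phi> n l"
      by (rule classifying_arrow_unique[OF nM n l Comp_in_Hom[OF a mb] mb_comp[OF sq]])
    ultimately have comm: "mb \<cdot> a = l' \<cdot> n'" by simp
    have "is_pullback C mb l' a n'"
    proof (rule pullbackI[OF mb l' a n' comm])
      fix X x y
      assume x: "x \<in> Hom C X G" and y: "y \<in> Hom C X (To K)" and xy: "mb \<cdot> x = l' \<cdot> y"
      \<comment> \<open>Recovers the partial map \<open>(e, h)\<close> from \<open>X\<close> to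
        \<open>K\<close> that \<open>y\<close> represents.\<close>
      obtain e h where eh: "is_pullback C y (\<eta> K) e h"
        using pullbacks y etaK unfolding has_pullbacks_def by (metis HomD(1,3))
      define P where "P = Dom C e"
      have e: "e \<in> Hom C P X" and h: "h \<in> Hom C P K" and eM: "e \<in> M"
        using pullback_HomD[OF eh] HomD[OF y] dom M_pullback[OF eh etaKM] unfolding P_def by auto
      note lh = Comp_in_Hom[OF h l]
      have outer: "is_pullback C (mb \<cdot> x) (\<eta> L) e (l \<cdot> h)"
        unfolding xy by (rule l'_comp[OF eh])
      \<comment> \<open>The second leg of the square of \<open>mb\<close> is an identity, so the
        lift \<open>w\<close> can only be \<open>l \<cdot> h\<close>.\<close>
      have xe: "x \<cdot> e = m \<cdot> (l \<cdot> h)"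
      proof -
        have "mb \<cdot> (x \<cdot> e) = \<eta> L \<cdot> (l \<cdot> h)"
          using pullback_commutes[OF outer] Comp_assoc[OF e x mb] by simp
        then obtain w where "w \<in> Hom C P L" "m \<cdot> w = x \<cdot> e" "Ident C L \<cdot> w = l \<cdot> h"
          using pullback_ex1[OF mb_pb, of "x \<cdot> e" P "l \<cdot> h"] Comp_in_Hom[OF e x] lh dom by auto
        then show ?thesis using Ident_Comp by metis
      qed
      have sq': "is_pullback C x m e (l \<cdot> h)"
        by (rule mb_cancel[OF outer x xe])
      have "\<exists>!g. g \<in> Hom C X D \<and> a \<cdot> g = x \<and> g \<cdot> e = n \<cdot> h"
        using fin[OF pullback_sym[OF sq'], of h] HomD(2)[OF lh] h HomD(2)[OF x] unfolding D_def
        by simp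
      then obtain u where u: "u \<in> Hom C X D" "a \<cdot> u = x" "u \<cdot> e = n \<cdot> h" by blast
      \<comment> \<open>Cancelling \<open>sq\<close> from \<open>sq'\<close> shows that
        \<open>n' \<cdot> u\<close> classifies \<open>(e, h)\<close>, as \<open>y\<close>
        does.\<close>
      have "is_pullback C u n e h"
        by (rule pullback_cancel[OF sq, of u e h X])
          (use sq' u h e n HomD[OF n] HomD[OF e] in \<open>auto simp: D_def\<close>)
      from pullback_paste[OF n'_pb this] have "is_pullback C (n' \<cdot> u) (\<eta> K) e h"
        using Ident_Comp[OF h] by simp
      then have "n' \<cdot> u = y"
        using classifying_arrow_unique[OF eM e h] Comp_in_Hom[OF u(1) n'] y eh by metis
      with u show "\<exists>u \<in> Hom C X D. a \<cdot> u = x \<and> n' \<cdot> u = y" by blast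
    next
      fix X u v
      assume u: "u \<in> Hom C X D" and v: "v \<in> Hom C X D"
        and auv: "a \<cdot> u = a \<cdot> v" and n'uv: "n' \<cdot> u = n' \<cdot> v"
      note n'u = Comp_in_Hom[OF u n'] and au = Comp_in_Hom[OF u a]
      obtain e h where eh: "is_pullback C (n' \<cdot> u) (\<eta> K) e h"
        using pullbacks n'u etaK unfolding has_pullbacks_def by (metis HomD(1,3))
      define P where "P = Dom C e"
      have e: "e \<in> Hom C P X" and h: "h \<in> Hom C P K"
        using pullback_HomD[OF eh] HomD[OF n'u] dom unfolding P_def by auto
      note lh = Comp_in_Hom[OF h l]
      \<comment> \<open>To be used for both \<open>u\<close> and \<open>v\<close>: with it, each
        solves the finality problem posed by \<open>a \<cdot> u\<close> and \<open>h\<close>, whose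
        solution is unique.\<close>
      have we: "w \<cdot> e = n \<cdot> h" if w: "w \<in> Hom C X D" and n'w: "n' \<cdot> w = n' \<cdot> u" for w
      proof -
        have "n' \<cdot> (w \<cdot> e) = \<eta> K \<cdot> h"
          using pullback_commutes[OF eh] Comp_assoc[OF e w n'] n'w by simp
        then obtain s where "s \<in> Hom C P K" "n \<cdot> s = w \<cdot> e" "Ident C K \<cdot> s = h"
          using pullback_ex1[OF n'_pb, of "w \<cdot> e" P h] Comp_in_Hom[OF e w] h dom HomD[OF n']
            HomD[OF n] by auto
        then show ?thesis using Ident_Comp by metis
      qed
      have "is_pullback C u n e (Ident C K \<cdot> h)"
        unfolding Ident_Comp[OF h]
        by (rule pullback_cancel[OF n'_pb, of u e h X])
          (use eh u h Ident_Comp[OF h] HomD[OF n'] HomD[OF n] we in \<open>auto simp: P_def\<close>)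
      then have "is_pullback C u n e h"
        using Ident_Comp[OF h] by simp
      from pullback_paste[OF sq this] have sq': "is_pullback C (a \<cdot> u) m e (l \<cdot> h)" .
      have "\<exists>!g. g \<in> Hom C X D \<and> a \<cdot> g = a \<cdot> u \<and> g \<cdot> e = n \<cdot> h"
        using fin[OF pullback_sym[OF sq'], of h] HomD(2)[OF lh] h HomD(2)[OF au] unfolding D_def
        by simp
      then show "u = v"
        using u v we auv n'uv by metis
    qed
    then show "\<exists>n'. is_pullback C mb l' a n' \<and> n \<in> Hom C K (Dom C a) \<and> n' \<cdot> n = \<eta> K \<and>
        a \<cdot> n = m \<cdot> l"
      using n n'n pullback_commutes[OF sq] unfolding D_def by blast
  next
    assume "\<exists>n'. is_pullback C mb l' a n' \<and> n \<in> Hom C K (Dom C a) \<and> n' \<cdot> n = \<eta> K \<and>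
      a \<cdot> n = m \<cdot> l"
    then obtain n' where pb: "is_pullback C mb l' a n'" and n: "n \<in> Hom C K (Dom C a)"
      and n'n: "n' \<cdot> n = \<eta> K" and an: "a \<cdot> n = m \<cdot> l" by blast
    define D where "D = Dom C a"
    have a: "a \<in> Hom C D G" and n': "n' \<in> Hom C D (To K)"
      using pullback_HomD[OF pb] dom unfolding D_def by auto
    have n: "n \<in> Hom C K D" using n unfolding D_def .
    \<comment> \<open>Here \<open>n'\<close> is given, and must be shown to classify
      \<open>(n, id)\<close>. For a cone \<open>(x, y)\<close> the equation
      \<open>x = n \<cdot> y\<close> is tested after \<open>a\<close> and after \<open>n'\<close>;
      the test after \<open>a\<close> goes through \<open>To L\<close> and the square of
      \<open>mb\<close>.\<close>
    have n'_pb: "is_pullback C n' (\<eta> K) n (Ident C K)"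
    proof (rule pullbackI[OF n' etaK n idK])
      show "n' \<cdot> n = \<eta> K \<cdot> Ident C K" using n'n Comp_Ident[OF etaK] by simp
    next
      fix X x y
      assume x: "x \<in> Hom C X D" and y: "y \<in> Hom C X K" and xy: "n' \<cdot> x = \<eta> K \<cdot> y"
      have "mb \<cdot> (a \<cdot> x) = l' \<cdot> (n' \<cdot> x)"
        using Comp_assoc[OF x a mb] Comp_assoc[OF x n' l'] pullback_commutes[OF pb] by simp
      also have "\<dots> = \<eta> L \<cdot> (l \<cdot> y)"
        unfolding xy using Comp_assoc[OF y etaK l'] Comp_assoc[OF y l etaL]
          pullback_commutes[OF l'_pb] by simp
      finally obtain w where "w \<in> Hom C X L" "m \<cdot> w = a \<cdot> x" "Ident C L \<cdot> w = l \<cdot> y"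
        using pullback_ex1[OF mb_pb, of "a \<cdot> x" X "l \<cdot> y"] Comp_in_Hom[OF x a]
          Comp_in_Hom[OF y l] dom by auto
      then have "a \<cdot> x = m \<cdot> (l \<cdot> y)" using Ident_Comp by metis
      also have "\<dots> = a \<cdot> (n \<cdot> y)"
        using Comp_assoc[OF y l m] Comp_assoc[OF y n a] an by simp
      finally have "a \<cdot> x = a \<cdot> (n \<cdot> y)" .
      moreover have "n' \<cdot> x = n' \<cdot> (n \<cdot> y)"
        using xy Comp_assoc[OF y n n'] n'n by simp
      ultimately have "x = n \<cdot> y"
        using pullback_joint_monic[OF pb, of x X "n \<cdot> y"] x Comp_in_Hom[OF y n]
        unfolding D_def by blast
      then show "\<exists>u \<in> Hom C X K. n \<cdot> u = x \<and> Ident C K \<cdot> u = y"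
        using y Ident_Comp[OF y] by blast
    next
      fix X u v
      assume "u \<in> Hom C X K" "v \<in> Hom C X K" "Ident C K \<cdot> u = Ident C K \<cdot> v"
      then show "u = v" using Ident_Comp by metis
    qed
    \<comment> \<open>The common composite \<open>mb \<cdot> a = l' \<cdot> n'\<close> classifies
      \<open>(n, l)\<close>; cancelling the square of \<open>mb\<close> leaves the required
      pullback.\<close>
    have "is_pullback C (mb \<cdot> a) (\<eta> L) n l"
      using l'_comp[OF n'_pb] Comp_Ident[OF l] pullback_commutes[OF pb] by simp
    from mb_cancel[OF this a an] have sq: "is_pullback C a m n l" .
    show "final_pullback_complement C l m n a"
      unfolding final_pullback_complement_def
    proof (intro conjI allI impI)
      fix d e f h
      assume dc: "is_pullback C m f d e" and h: "h \<in> Hom C (Dom C d) (Dom C l)"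
        and lh: "l \<cdot> h = d"
      define P where "P = Dom C e"
      define X where "X = Dom C f"
      note sq' = pullback_sym[OF dc]
      have f: "f \<in> Hom C X G" and e: "e \<in> Hom C P X" and d: "d \<in> Hom C P L"
        using pullback_HomD[OF sq'] HomD[OF m] dom unfolding P_def X_def by auto
      have h: "h \<in> Hom C P K" using h dom HomD(2)[OF d] by simp
      have eM: "e \<in> M" by (rule M_pullback[OF sq' mM])
      note c = classifying_arrow[OF eM e h]
      \<comment> \<open>Since both composites classify \<open>(e, d)\<close>, the pair of
        \<open>f\<close> and \<open>\<phi> e h\<close> is a cone; \<open>g\<close> is its mediating
        arrow.\<close>
      have "l' \<cdot> \<phi> e h = \<phi> e d"
        using classifying_arrow_unique[OF eM e d Comp_in_Hom[OF c(1) l']] l'_comp[OF c(2)] lh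
        by simp
      moreover have "mb \<cdot> f = \<phi> e d"
        by (rule classifying_arrow_unique[OF eM e d Comp_in_Hom[OF f mb] mb_comp[OF sq']])
      ultimately have "mb \<cdot> f = l' \<cdot> \<phi> e h" by simp
      then obtain g where g: "g \<in> Hom C X D" "a \<cdot> g = f" "n' \<cdot> g = \<phi> e h"
        using pullback_ex1[OF pb, of f X "\<phi> e h"] f c(1) dom unfolding D_def by auto
      have "a \<cdot> (g \<cdot> e) = a \<cdot> (n \<cdot> h)"
        using Comp_assoc[OF e g(1) a] Comp_assoc[OF h n a] Comp_assoc[OF h l m] g(2) an lh
          pullback_commutes[OF sq'] by simp
      moreover have "n' \<cdot> (g \<cdot> e) = n' \<cdot> (n \<cdot> h)"
        using Comp_assoc[OF e g(1) n'] Comp_assoc[OF h n n'] g(3) n'n pullback_commutes[OF c(2)]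
        by simp
      ultimately have ge: "g \<cdot> e = n \<cdot> h"
        using pullback_joint_monic[OF pb, of "g \<cdot> e" P "n \<cdot> h"] Comp_in_Hom[OF e g(1)]
          Comp_in_Hom[OF h n] unfolding D_def by blast
      \<comment> \<open>Any competitor makes \<open>n' \<cdot> g1\<close> classify
        \<open>(e, h)\<close>, so it agrees with \<open>g\<close> after \<open>n'\<close> as well as
        after \<open>a\<close>.\<close>
      have "g1 = g" if g1: "g1 \<in> Hom C X D" "a \<cdot> g1 = f" "g1 \<cdot> e = n \<cdot> h" for g1
      proof -
        have "is_pullback C g1 n e h"
          by (rule pullback_cancel[OF sq, of g1 e h X])
            (use sq' lh g1 h HomD[OF n] HomD[OF e] in \<open>auto simp: D_def\<close>)
        from pullback_paste[OF n'_pb this] have "is_pullback C (n' \<cdot> g1) (\<eta> K) e h"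
          using Ident_Comp[OF h] by simp
        with c(3)[OF Comp_in_Hom[OF g1(1) n']] g(3) have "n' \<cdot> g1 = n' \<cdot> g" by simp
        then show "g1 = g"
          using pullback_joint_monic[OF pb, of g1 X g] g g1 unfolding D_def by blast
      qed
      with g ge show "\<exists>!g. g \<in> Hom C (Dom C f) (Dom C a) \<and> a \<cdot> g = f \<and> g \<cdot> e = n \<cdot> h"
        unfolding X_def D_def by blast
    qed (fact sq)
  qed
qed

end

theorem theorem2:
  fixes C :: "('o, 'a) category"
    and M :: "'a set"
    and To :: "'o \<Rightarrow> 'o" and Ta :: "'a \<Rightarrow> 'a" and \<eta> :: "'o \<Rightarrow> 'a"
    and K L R G H :: 'o
    and l r m :: 'a
  assumes "category C"
    and "has_pullbacks C"
    and "stable_system_of_monos C M"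
    and "partial_map_classifier C M To Ta \<eta>"
    and "has_pushouts_along C M"
    and "l \<in> Hom C K L" and "r \<in> Hom C K R"
    and "m \<in> Hom C L G" and "m \<in> M"
  shows "sqpo_step C l r m G H \<longleftrightarrow> agree_step C M To \<eta> l r (\<eta> K) m G H"
proof -
  interpret category C by fact
  interpret classified_category C M To Ta \<eta>
    by unfold_locales fact+
  have dom: "Dom C l = K" "Cod C l = L" "Dom C m = L"
    using HomD assms(6,8) by metis+
  have K: "K \<in> Obj C"
    using Dom_in_Obj[OF HomD(1)[OF assms(6)]] dom by simp
  have span: "is_span C l r"
    using HomD[OF assms(6)] HomD[OF assms(7)] by (simp add: is_span_def)
  then have rule: "agree_rule C M l r (\<eta> K)"
    using HomD[OF unit_in_Hom[OF K]] unit_in_M[OF K] dom by (simp add: agree_rule_def)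
  show ?thesis
    \<comment> \<open>After the rewriting, the two sides differ only in the order of existential
      quantifiers and conjuncts.\<close>
    unfolding sqpo_step_def agree_step_def mono_classifying_arrow_def dom
      final_pullback_complement_iff[OF assms(6,8,9)]
    using span rule assms(8,9) by simp (rule iffI; elim exE conjE; intro exI conjI; assumption)
qed

end
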